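(* Let $S\ge2$ and $2\le N\le K$ be integers and let $M=\frac{NS^{N-1}-q}{KS^{N-1}}$. Let $R(M)$ denote the rate of the proposed scheme at $M$, namely $$R(M)=\begin{cases}\dfrac{q}{S^{N-1}} & \text{if } N=K,\\[2mm] \dfrac NK\left(\dfrac{q}{S^{N-1}}+K-N\right) & \text{if } N<K,\end{cases}$$ and let $R_{PD}(M)$ denote the rate of the product design scheme at $M$. Then $$R_{PD}(M)-R(M)>0.$$
   Context: Definition of $q$: for $k\in\{1,\dots,N\}$ put $g(S,k)=\frac{S-1}{S}[(-1)^{k-1}+(S-1)^{k-2}]$, $f(S,k)=\frac1S[(-1)^k+(S-1)^{k-1}]$; $\phi_1(S,k)=g(S,k)$ and $\phi_s(S,k)=f(S,k)$ for $2\le s\le S$; $\psi_s(S,k)=\left\lceil\frac{k(N-1)}{N}\phi_s(S,k)\right\rceil$; and $q=\sum_{k=1}^N\sum_{s=1}^S\binom Nk\psi_s(S,k)$. Rate of the product design (PD) scheme: for $t\in\{1,\dots,K\}$, $$R_{PD}\!\left(\tfrac{tN}{K}\right)=\min\left(N\left(1-\tfrac tK\right),\ \tfrac{K-t}{t+1}\left(1+\tfrac1S+\cdots+\tfrac1{S^{N-1}}\right)\right),$$ and for general cache size $M\in[0,N]$, $R_{PD}(M)$ is the value at $M$ of the lower convex envelope of the points $(0,N)$ and $\left(\frac{tN}K,R_{PD}\left(\frac{tN}K\right)\right)$, $t\in\{1,\dots,K\}$. *)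

theory Defs
  imports "HOL-Analysis.Analysis"
begin

text \<open>Integer exponents are needed in \<open>g\<close>: for \<open>k = 1\<close> the exponent \<open>k - 2\<close> is \<open>-1\<close>.\<close>

definition g :: "nat \<Rightarrow> nat \<Rightarrow> real" where
  "g S k = (real S - 1) / real S * ((-1) powi (int k - 1) + (real S - 1) powi (int k - 2))"

definition f :: "nat \<Rightarrow> nat \<Rightarrow> real" where
  "f S k = 1 / real S * ((-1) ^ k + (real S - 1) powi (int k - 1))"

definition phi :: "nat \<Rightarrow> nat \<Rightarrow> nat \<Rightarrow> real" where
  "phi S s k = (if s = 1 then g S k else f S k)"

definition psi :: "nat \<Rightarrow> nat \<Rightarrow> nat \<Rightarrow> nat \<Rightarrow> int" where
  "psi S N s k = \<lceil>real k * (real N - 1) / real N * phi S s k\<rceil>"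

definition q :: "nat \<Rightarrow> nat \<Rightarrow> int" where
  "q S N = (\<Sum>k = 1..N. \<Sum>s = 1..S. int (N choose k) * psi S N s k)"

text \<open>The rate of the proposed scheme at its only cache size,
  \<open>(N S ^ (N - 1) - q) / (K S ^ (N - 1))\<close>; hence no cache size argument.\<close>

definition proposed_rate :: "nat \<Rightarrow> nat \<Rightarrow> nat \<Rightarrow> real" where
  "proposed_rate S N K =
     (if N = K then of_int (q S N) / real S ^ (N - 1)
      else real N / real K * (of_int (q S N) / real S ^ (N - 1) + real K - real N))"

text \<open>The lower boundary of the convex hull; meaningful at those \<open>x\<close> lying in the
  projection of the hull to the first coordinate.\<close>

definition lower_convex_envelope :: "(real \<times> real) set \<Rightarrow> real \<Rightarrow> real" where
  "lower_convex_envelope P x = Inf {y. (x, y) \<in> convex hull P}"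

text \<open>\<open>pd_corner S N K t\<close> is the rate of the product design scheme assigned to the cache
  size \<open>t N / K\<close>. It can lie strictly above the envelope \<open>pd_rate\<close> at that cache size.\<close>

definition pd_corner :: "nat \<Rightarrow> nat \<Rightarrow> nat \<Rightarrow> nat \<Rightarrow> real" where
  "pd_corner S N K t =
     min (real N * (1 - real t / real K))
         ((real K - real t) / (real t + 1) * (\<Sum>i<N. 1 / real S ^ i))"

definition pd_points :: "nat \<Rightarrow> nat \<Rightarrow> nat \<Rightarrow> (real \<times> real) set" where
  "pd_points S N K =
     insert (0, real N) ((\<lambda>t. (real t * real N / real K, pd_corner S N K t)) ` {1..K})"

definition pd_rate :: "nat \<Rightarrow> nat \<Rightarrow> nat \<Rightarrow> real \<Rightarrow> real" where
  "pd_rate S N K M = lower_convex_envelope (pd_points S N K) M"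

end

theory Submission
  imports Defs
begin

text \<open>
  Both branches of the proposed rate equal \<open>N - N * M\<close>, a line through the corner \<open>(0, N)\<close>.
  All other corners of the product design scheme lie strictly above this line. As \<open>phi\<close> takes
  nonnegative integer values, the ceilings give \<open>0 \<le> q < N * S ^ (N - 1)\<close>, that is
  \<open>0 < M \<le> N / K\<close>. So any convex combination of corners with abscissa \<open>M\<close> puts positive
  weight on a corner other than \<open>(0, N)\<close> and lies strictly above the line.
\<close>

section \<open>Integrality, sign and row sums of \<open>phi\<close>\<close>

lemma f_Suc: "f S (Suc j) = ((real S - 1) ^ j - (-1) ^ j) / real S"
  by (simp add: f_def)

text \<open>In this form \<open>g\<close> inherits integrality from \<open>f\<close>, and adding the
  \<open>S - 1\<close> copies of \<open>f\<close> leaves a pure power.\<close>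

lemma g_Suc:
  assumes "2 \<le> S"
  shows "g S (Suc j) = (real S - 1) ^ j - (real S - 1) * f S (Suc j)"
proof -
  have "(real S - 1) * (real S - 1) powi (int j - 1) = (real S - 1) ^ j"
    \<comment> \<open>For \<open>j = 0\<close> the exponent is -1, and the cancellation needs
      \<open>S - 1\<close> to be nonzero.\<close>
    using assms by (cases j) (simp_all add: power_int_minus field_simps)
  moreover have "g S (Suc j) =
      ((real S - 1) * (-1) ^ j + (real S - 1) * (real S - 1) powi (int j - 1)) / real S"
    by (simp add: g_def distrib_left add_divide_distrib)
  ultimately have "g S (Suc j) = ((real S - 1) * (-1) ^ j + (real S - 1) ^ j) / real S"
    by simp
  then show ?thesis
    using assms by (simp add: f_Suc field_simps)
qed

text \<open>Consecutive values of \<open>f\<close> add up to a power of \<open>S - 1\<close>, so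
  integrality propagates from the value 0 at \<open>j = 0\<close>.\<close>

lemma f_Suc_Ints:
  assumes "S \<noteq> 0"
  shows "f S (Suc j) \<in> \<int>"
proof (induction j)
  case 0
  show ?case by (simp add: f_Suc)
next
  case (Suc j)
  have "f S (Suc (Suc j)) = (real S - 1) ^ j - f S (Suc j)"
    using assms by (simp add: f_Suc field_simps)
  then show ?case using Suc by simp
qed

lemma f_Suc_nonneg:
  assumes "2 \<le> S"
  shows "0 \<le> f S (Suc j)"
proof -
  have "(-1 :: real) ^ j \<le> 1"
    by (cases "even j") auto
  also have "\<dots> \<le> (real S - 1) ^ j"
    using assms by (intro one_le_power) simp
  finally show ?thesis by (simp add: f_Suc)
qed

lemma g_Suc_nonneg:
  assumes "2 \<le> S"
  shows "0 \<le> g S (Suc j)"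
proof (cases j)
  case 0
  then show ?thesis using assms by (simp add: g_Suc f_Suc)
next
  case (Suc i)
  have "g S (Suc j) = (real S - 1) * f S (Suc i)"
    using assms by (simp add: g_Suc f_Suc Suc field_simps)
  then show ?thesis using assms f_Suc_nonneg[OF assms] by simp
qed

lemma phi_Ints:
  assumes "2 \<le> S" "1 \<le> k"
  shows "phi S s k \<in> \<int>"
proof -
  obtain j where "k = Suc j" using assms by (cases k) auto
  then show ?thesis using assms by (simp add: phi_def g_Suc f_Suc_Ints)
qed

lemma phi_nonneg:
  assumes "2 \<le> S" "1 \<le> k"
  shows "0 \<le> phi S s k"
proof -
  obtain j where "k = Suc j" using assms by (cases k) auto
  then show ?thesis using assms by (simp add: phi_def g_Suc_nonneg f_Suc_nonneg)
qed

lemma sum_phi: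
  assumes "2 \<le> S" "1 \<le> k"
  shows "(\<Sum>s = 1..S. phi S s k) = (real S - 1) ^ (k - 1)"
proof -
  obtain j where k: "k = Suc j" using assms by (cases k) auto
  have "(\<Sum>s = 1..S. phi S s k) = phi S 1 k + (\<Sum>s = 2..S. phi S s k)"
    using assms by (simp add: sum.atLeast_Suc_atMost numeral_2_eq_2)
  also have "(\<Sum>s = 2..S. phi S s k) = (\<Sum>s = 2..S. f S k)"
    by (intro sum.cong) (auto simp: phi_def)
  also have "\<dots> = (real S - 1) * f S k"
    using assms by (simp add: of_nat_diff)
  finally show ?thesis using assms by (simp add: k phi_def g_Suc)
qed

section \<open>Effect of the ceilings and bounds for \<open>q\<close>\<close>

lemma psi_nonneg:
  assumes "2 \<le> S" "1 \<le> N" "1 \<le> k"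
  shows "0 \<le> psi S N s k"
proof -
  have "0 \<le> real k * (real N - 1) / real N * phi S s k"
    using assms phi_nonneg[of S k s] by simp
  then show ?thesis unfolding psi_def by linarith
qed

text \<open>The factor \<open>(N - 1) / N\<close> is at most 1, and rounding up cannot pass the
  integer \<open>k * phi S s k\<close>.\<close>

lemma psi_le:
  assumes "2 \<le> S" "1 \<le> N" "1 \<le> k"
  shows "real_of_int (psi S N s k) \<le> real k * phi S s k"
proof -
  obtain m where m: "phi S s k = of_int m"
    using phi_Ints assms by (metis Ints_cases)
  have "real k * (real N - 1) / real N * phi S s k \<le> real k * phi S s k"
    using assms phi_nonneg[of S k s] by (intro mult_right_mono) (auto simp: field_simps)
  also have "\<dots> = of_int (int k * m)" by (simp add: m)
  finally have "psi S N s k \<le> int k * m"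
    unfolding psi_def by (simp only: ceiling_le_iff)
  then have "real_of_int (psi S N s k) \<le> of_int (int k * m)"
    by (simp only: of_int_le_iff)
  then show ?thesis by (simp add: m)
qed

text \<open>At \<open>k = N\<close> the ceiling is taken of an integer, so nothing is lost to
  rounding. This makes the bound in \<open>q_less\<close> strict.\<close>

lemma psi_diagonal:
  assumes "2 \<le> S" "1 \<le> N"
  shows "real_of_int (psi S N s N) = (real N - 1) * phi S s N"
proof -
  obtain m where m: "phi S s N = of_int m"
    using phi_Ints assms by (metis Ints_cases)
  have "real N * (real N - 1) / real N * phi S s N = of_int ((int N - 1) * m)"
    using assms by (simp add: m)
  then have "psi S N s N = (int N - 1) * m"
    unfolding psi_def by (simp only: ceiling_of_int)
  then show ?thesis by (simp add: m)
qed

text \<open>This is the derivative of the binomial expansion of \<open>(x + 1) ^ N\<close>, obtained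
  from the absorption identity for binomial coefficients.\<close>

lemma sum_binomial_deriv:
  fixes x :: real
  assumes "1 \<le> N"
  shows "(\<Sum>k = 1..N. real (N choose k) * (real k * x ^ (k - 1))) = real N * (x + 1) ^ (N - 1)"
proof -
  obtain n where n: "N = Suc n" using assms by (cases N) auto
  have "(\<Sum>k = 1..N. real (N choose k) * (real k * x ^ (k - 1)))
      = (\<Sum>k\<le>n. real (Suc n choose Suc k) * (real (Suc k) * x ^ k))"
    by (rule sum.reindex_bij_witness[of _ Suc "\<lambda>k. k - 1"]) (auto simp: n)
  also have "\<dots> = (\<Sum>k\<le>n. real (Suc n) * (real (n choose k) * x ^ k))"
  proof (intro sum.cong refl)
    fix k
    have "real (Suc k) * real (Suc n choose Suc k) = real (Suc n) * real (n choose k)"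
      by (metis Suc_times_binomial of_nat_mult)
    then show "real (Suc n choose Suc k) * (real (Suc k) * x ^ k)
        = real (Suc n) * (real (n choose k) * x ^ k)"
      by (metis mult.assoc mult.commute)
  qed
  also have "\<dots> = real (Suc n) * (x + 1) ^ n"
    by (simp add: binomial_ring sum_distrib_left)
  finally show ?thesis by (simp add: n)
qed

lemma q_nonneg:
  assumes "2 \<le> S" "1 \<le> N"
  shows "0 \<le> q S N"
  unfolding q_def using assms by (intro sum_nonneg mult_nonneg_nonneg psi_nonneg) auto

lemma q_less:
  assumes "2 \<le> S" "1 \<le> N"
  shows "real_of_int (q S N) < real N * real S ^ (N - 1)"
proof -
  let ?a = "\<lambda>k. real (N choose k) * (real k * (real S - 1) ^ (k - 1))"
  let ?b = "\<lambda>k. \<Sum>s = 1..S. real (N choose k) * real_of_int (psi S N s k)"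
  have le: "?b k \<le> ?a k" if "k \<in> {1..N}" for k
  proof -
    have "?b k \<le> (\<Sum>s = 1..S. real (N choose k) * (real k * phi S s k))"
      using assms that by (intro sum_mono mult_left_mono psi_le) auto
    also have "\<dots> = ?a k"
      using assms that by (simp add: sum_distrib_left[symmetric] sum_phi[simplified])
    finally show ?thesis .
  qed
  have "?b N = (real N - 1) * (\<Sum>s = 1..S. phi S s N)"
    using assms by (simp add: psi_diagonal sum_distrib_left)
  also have "\<dots> = (real N - 1) * (real S - 1) ^ (N - 1)"
    using assms by (simp only: sum_phi)
  \<comment> \<open>The gap is \<open>(S - 1) ^ (N - 1)\<close>, positive because \<open>S\<close>
    is at least 2.\<close>
  also have "\<dots> < ?a N"
    using assms by (simp add: algebra_simps)
  finally have less: "?b N < ?a N" .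
  have "real_of_int (q S N) = (\<Sum>k = 1..N. ?b k)"
    by (simp add: q_def)
  also have "\<dots> < (\<Sum>k = 1..N. ?a k)"
  proof (rule sum_strict_mono_ex1)
    show "\<forall>k\<in>{1..N}. ?b k \<le> ?a k" using le by blast
    have "N \<in> {1..N}" using assms by simp
    then show "\<exists>k\<in>{1..N}. ?b k < ?a k" using less by blast
  qed simp
  also have "\<dots> = real N * real S ^ (N - 1)"
    using sum_binomial_deriv[of N "real S - 1"] assms by simp
  finally show ?thesis .
qed

section \<open>The product design envelope against the line\<close>

lemma lower_convex_envelope_ge:
  assumes above: "\<And>x y. (x, y) \<in> P \<Longrightarrow> a + b * x \<le> y"
    and x: "x \<in> fst ` (convex hull P)"
  shows "a + b * x \<le> lower_convex_envelope P x"
proof -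
  have "P \<subseteq> {p. inner (b, -1) p \<le> -a}"
    using above by force
  then have hull: "convex hull P \<subseteq> {p. inner (b, -1) p \<le> -a}"
    by (intro hull_minimal convex_halfspace_le)
  show ?thesis
    unfolding lower_convex_envelope_def
  proof (rule cInf_greatest)
    \<comment> \<open>The bound passes to \<open>Inf\<close> only for a nonempty set, hence the
      assumption on the projection of the hull.\<close>
    show "{y. (x, y) \<in> convex hull P} \<noteq> {}" using x by auto
    show "a + b * x \<le> y" if "y \<in> {y. (x, y) \<in> convex hull P}" for y
      using that hull by force
  qed
qed

text \<open>Both arguments of the minimum are compared with the line. For the second, the geometric
  sum is first replaced by its lower bound 1.\<close>

lemma pd_corner_above_line:
  assumes "2 \<le> S" "2 \<le> N" "N \<le> K" "1 \<le> t" "t \<le> K"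
  shows "real N - real N * (real t * real N / real K) < pd_corner S N K t"
proof -
  let ?A = "\<Sum>i<N. 1 / real S ^ i"
  have A: "1 \<le> ?A"
    using member_le_sum[of 0 "{..<N}" "\<lambda>i. 1 / real S ^ i"] assms by simp
  have pos: "0 < real K" "0 < real t" "0 < real N" using assms by auto
  have "real N * (real t / real K) < real N * (real N * (real t / real K))"
    using assms pos by (intro mult_strict_left_mono) (auto simp: field_simps)
  then have 1: "real N - real N * (real t * real N / real K) < real N * (1 - real t / real K)"
    by (simp add: algebra_simps)
  have "real N - real N * (real t * real N / real K) < (real K - real t) / (real t + 1)"
  \<comment> \<open>In the first case the line has already dropped to 0 or below. Otherwise
    \<open>2 * t < K\<close>, which makes the final comparison of \<open>K / 2\<close> with
    \<open>K - t\<close> strict.\<close>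
  proof (cases "K \<le> t * N")
    case True
    then have ge: "real K \<le> real t * real N" by (metis of_nat_le_iff of_nat_mult)
    show ?thesis
    proof (cases "t = K")
      case True
      then show ?thesis using assms by simp
    next
      case False
      then have "0 < (real K - real t) / (real t + 1)" using assms by simp
      moreover have "real N * 1 \<le> real N * (real t * real N / real K)"
        using ge pos by (intro mult_left_mono) auto
      ultimately show ?thesis by linarith
    qed
  next
    case False
    then have "real t * real N < real K"
      by (metis not_le of_nat_less_iff of_nat_mult)
    moreover have "real t * 2 \<le> real t * real N"
      using assms by (intro mult_left_mono) auto
    ultimately have "real t * 2 < real K" by linarith
    have "0 \<le> (2 * real t * real N - real K)\<^sup>2" by simp
    \<comment> \<open>maximizes the quadratic in \<open>N\<close> on the left, at \<open>N = K / (2 * t)\<close>\<close>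
    then have "real N - real N * (real t * real N / real K) \<le> real K / (4 * real t)"
      using pos by (simp add: field_simps power2_eq_square)
    also have "\<dots> \<le> real K / (2 * (real t + 1))"
      using assms pos by (intro divide_left_mono) auto
    also have "\<dots> = (real K / 2) / (real t + 1)"
      by simp
    also have "\<dots> < (real K - real t) / (real t + 1)"
      using \<open>real t * 2 < real K\<close> by (intro divide_strict_right_mono) auto
    finally show ?thesis .
  qed
  also have "\<dots> \<le> (real K - real t) / (real t + 1) * ?A"
    using A assms mult_left_mono[OF A, of "(real K - real t) / (real t + 1)"] by simp
  finally show ?thesis using 1 by (simp add: pd_corner_def)
qed

lemma fst_convex_hull_pd_points:
  assumes "1 \<le> K" "0 \<le> x" "x \<le> real N"
  shows "x \<in> fst ` (convex hull pd_points S N K)"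
proof -
  let ?F = "fst ` (convex hull pd_points S N K)"
  have "(0, real N) \<in> pd_points S N K"
    by (simp add: pd_points_def)
  then have 0: "0 \<in> ?F"
    by (metis fst_conv hull_inc image_eqI)
  have "(real K * real N / real K, pd_corner S N K K) \<in> pd_points S N K"
    unfolding pd_points_def using assms by (intro insertI2 image_eqI[of _ _ K]) auto
  then have "(real N, pd_corner S N K K) \<in> pd_points S N K"
    using assms by simp
  then have N: "real N \<in> ?F"
    by (metis fst_conv hull_inc image_eqI)
  have "convex ?F"
    by (intro convex_linear_image linear_fst convex_convex_hull)
  then have "closed_segment 0 (real N) \<subseteq> ?F"
    using 0 N by (simp add: closed_segment_subset)
  then show ?thesis using assms by (auto simp: closed_segment_eq_real_ivl)
qed

text \<open>An infimum preserves only weak inequalities. As there are finitely many corners, the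
  line can be tilted upwards about \<open>(0, N)\<close> by a slope \<open>d > 0\<close> and still
  lie below all of them; at \<open>x > 0\<close> this gains \<open>d * x\<close>.\<close>

lemma pd_rate_above_line:
  assumes "2 \<le> S" "2 \<le> N" "N \<le> K" "0 < x" "x \<le> real N"
  shows "real N - real N * x < pd_rate S N K x"
proof -
  let ?x = "\<lambda>t. real t * real N / real K"
  \<comment> \<open>The slope from \<open>(0, N)\<close> to corner \<open>t\<close>, minus the slope
    \<open>-N\<close> of the line.\<close>
  let ?d = "\<lambda>t. (pd_corner S N K t - real N) / ?x t + real N"
  define d where "d = Min (?d ` {1..K})"
  have pos: "0 < ?x t" if "t \<in> {1..K}" for t
    using that assms by simp
  have "0 < ?d t" if "t \<in> {1..K}" for t
    using pos[OF that] pd_corner_above_line[of S N K t] assms that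
    by (simp add: field_simps)
  then have "0 < d"
    unfolding d_def using assms by (subst Min_gr_iff) auto
  have "real N + (d - real N) * u \<le> v" if "(u, v) \<in> pd_points S N K" for u v
  proof -
    consider "u = 0" "v = real N" | t where "t \<in> {1..K}" "u = ?x t" "v = pd_corner S N K t"
      using \<open>(u, v) \<in> pd_points S N K\<close> unfolding pd_points_def by auto
    then show ?thesis
    proof cases
      case 2
      then have "d \<le> ?d t" unfolding d_def by (intro Min_le) auto
      then have "d - real N \<le> (v - real N) / u" using 2 by simp
      moreover have "0 < u" using pos 2 by simp
      ultimately show ?thesis by (simp add: pos_le_divide_eq)
    qed simp
  qed
  then have "real N + (d - real N) * x \<le> pd_rate S N K x"
    unfolding pd_rate_def using assms
    by (intro lower_convex_envelope_ge fst_convex_hull_pd_points) auto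
  moreover have "0 < d * x" using \<open>0 < d\<close> assms by simp
  ultimately show ?thesis by (simp add: algebra_simps)
qed

theorem lemma3:
  fixes S N K :: nat and M :: real
  assumes "2 \<le> S" and "2 \<le> N" and "N \<le> K"
    and "M = (real N * real S ^ (N - 1) - of_int (q S N)) / (real K * real S ^ (N - 1))"
  shows "pd_rate S N K M - proposed_rate S N K > 0"
proof -
  define L where "L = real S ^ (N - 1)"
  have L: "0 < L" and K: "1 \<le> real K" using assms by (auto simp: L_def)
  have M: "M = (real N * L - of_int (q S N)) / (real K * L)"
    using assms(4) by (simp add: L_def)
  have "0 < M"
    using q_less[of S N] assms(1,2) L K by (simp add: M L_def)
  \<comment> \<open>Solving for \<open>q\<close> expresses the rate through \<open>M\<close> and
    turns \<open>0 \<le> q\<close> into \<open>K * M \<le> N\<close>.\<close>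
  have Q: "of_int (q S N) / L = real N - real K * M"
    using L K by (simp add: M field_simps)
  have "0 \<le> of_int (q S N) / L"
    using q_nonneg[of S N] assms L by simp
  then have "real K * M \<le> real N" using Q by simp
  moreover have "1 * M \<le> real K * M"
    using K \<open>0 < M\<close> by (intro mult_right_mono) auto
  ultimately have "M \<le> real N" by simp
  have "proposed_rate S N K = real N - real N * M"
  proof (cases "N = K")
    case True
    then have "proposed_rate S N K = of_int (q S N) / L"
      by (simp add: proposed_rate_def L_def)
    then show ?thesis using Q True by simp
  next
    case False
    then have "proposed_rate S N K = real N / real K * (real N - real K * M + real K - real N)"
      by (simp only: proposed_rate_def L_def[symmetric] Q if_False)
    also have "\<dots> = real N - real N * M"
      using K by (simp add: field_simps)
    finally show ?thesis .
  qed
  then show ?thesis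
    using pd_rate_above_line[of S N K M] assms \<open>0 < M\<close> \<open>M \<le> real N\<close> by simp
qed

end
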